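(* Let $\mathbb{X}$ be a finite-dimensional Euclidean space, let $f:\mathbb{X}\to\mathbb{R}$ be a twice continuously differentiable convex function, let $g:\mathbb{X}\to\mathbb{R}\cup\{+\infty\}$ be a proper convex polyhedral function, and put $\varphi:=f+g$. Suppose that $\bar x$ is a tilt stable minimizer of $\varphi$, i.e., $\bar z:=-\nabla f(\bar x)\in\partial g(\bar x)$ and $$\operatorname{Ker}\nabla^2 f(\bar x)\cap \operatorname{par}\partial g^*(-\nabla f(\bar x))=\{0\},$$ and that the Hessian $\nabla^2 f$ is Lipschitz continuous around $\bar x$. Let $\eta>0$ be given. Then there exists $\varepsilon>0$ such that for any starting point $x_0$ with $\|x_0-\bar x\|\le\varepsilon$, and any sequence of pairs $(y_k,z_k)\in\operatorname{gph}\partial g$, $k\in\mathbb{N}\cup\{0\}$, selected during the iterations of Algorithm 1 (described in the context) so that $$\|z_k-\bar z\|+\|y_k-\bar x\|\le \eta\|x_k-\bar x\|\quad\text{for all }k,$$ the following assertions hold: (i) For every $k$, with $L_k:=\operatorname{par}\partial g^*(z_k)$, the problem $$\min_{d\in L_k}\ \tfrac12\langle\nabla^2 f(y_k)d,d\rangle-\langle z_k+\nabla f(y_k),d\rangle$$ has an optimal solution $d_k$ and it is unique (so that $d_k$ is well-defined). (ii) The sequence $\{x_k\}$ generated by Algorithm 1, i.e., $x_{k+1}=y_k-d_k$, converges quadratically to $\bar x$.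
   Context: Notation. $\partial g$ is the convex subdifferential of $g$, $\operatorname{gph}\partial g=\{(y,z)\mid z\in\partial g(y)\}$, and $g^*(v)=\sup_{x}\{\langle v,x\rangle-g(x)\}$ is the Legendre–Fenchel conjugate. A proper function $g$ is convex polyhedral (piecewise linear) if its epigraph is the intersection of finitely many closed half-spaces in $\mathbb{X}\times\mathbb{R}$. For a nonempty convex set $C$, its parallel subspace is $\operatorname{par}C:=\operatorname{span}(C-x)$ for any $x\in C$ (independent of the choice of $x$). Tilt stability. A point $\bar x\in\operatorname{dom}\varphi$ is a tilt stable minimizer of a lower semicontinuous convex function $\varphi$ if there is $\gamma>0$ such that the mapping $M_\gamma(v):=\operatorname{argmin}\{\varphi(x)-\langle v,x\rangle\mid \|x-\bar x\|\le\gamma\}$ is single-valued and Lipschitz continuous on some neighborhood of $0\in\mathbb{X}$ with $M_\gamma(0)=\{\bar x\}$. For the functions $\varphi=f+g$ considered here this is known to be equivalent to the two conditions displayed after "i.e." in the claim. Algorithm 1 (Newton method with effective subspaces). Input: $x_0\in\mathbb{X}$, $\eta>0$. For $k=0,1,2,\dots$: (1) find $(y_k,z_k)\in\operatorname{gph}\partial g$ satisfying $\|z_k-\bar z\|+\|y_k-\bar x\|\le\eta\|x_k-\bar x\|$; (2) put $L_k:=\operatorname{par}\partial g^*(z_k)$ and let $d_k\in L_k$ be an optimal solution of $\min_{d\in L_k}\frac12\langle\nabla^2 f(y_k)d,d\rangle-\langle z_k+\nabla f(y_k),d\rangle$; (3) set $x_{k+1}=y_k-d_k$. Quadratic convergence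 of $\{x_k\}$ to $\bar x$ means that $x_k\to\bar x$ and there is a constant $C>0$ (independent of $x_0$) such that $\|x_{k+1}-\bar x\|\le C\|x_k-\bar x\|^2$ for all $k$. *)

theory Defs
  imports "HOL-Analysis.Analysis"
begin

definition proper :: "('a \<Rightarrow> ereal) \<Rightarrow> bool" where
  "proper g \<longleftrightarrow> (\<forall>x. g x \<noteq> - \<infinity>) \<and> (\<exists>x. g x \<noteq> \<infinity>)"

definition ereal_epigraph :: "('a \<Rightarrow> ereal) \<Rightarrow> ('a \<times> real) set" where
  "ereal_epigraph g = {(x, r). g x \<le> ereal r}"

definition convex_polyhedral :: "('a::euclidean_space \<Rightarrow> ereal) \<Rightarrow> bool" where
  "convex_polyhedral g \<longleftrightarrow> polyhedron (ereal_epigraph g)"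

text \<open>The subdifferential is empty outside the effective domain. For proper \<open>g\<close> the finiteness
  condition already follows from the inequality.\<close>

definition subdifferential :: "('a::real_inner \<Rightarrow> ereal) \<Rightarrow> 'a \<Rightarrow> 'a set" where
  "subdifferential g x =
     {z. \<bar>g x\<bar> \<noteq> \<infinity> \<and> (\<forall>y. g x + ereal (z \<bullet> (y - x)) \<le> g y)}"

definition conjugate :: "('a::real_inner \<Rightarrow> ereal) \<Rightarrow> 'a \<Rightarrow> ereal" where
  "conjugate g v = (SUP x. ereal (v \<bullet> x) - g x)"

definition par :: "'a::real_vector set \<Rightarrow> 'a set" where
  "par C = span ((\<lambda>y. y - (SOME x. x \<in> C)) ` C)"

lemma par_eq:
  assumes "x \<in> C"
  shows "par C = span ((\<lambda>y. y - x) ` C)"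
proof -
  have sub: "span ((\<lambda>y. y - a) ` C) \<subseteq> span ((\<lambda>y. y - b) ` C)" if "a \<in> C" "b \<in> C" for a b
  proof (rule span_minimal[OF _ subspace_span], clarify)
    fix y assume "y \<in> C"
    then have "(y - b) - (a - b) \<in> span ((\<lambda>y. y - b) ` C)"
      using that by (intro span_diff span_base) auto
    then show "y - a \<in> span ((\<lambda>y. y - b) ` C)" by simp
  qed
  have "(SOME x. x \<in> C) \<in> C" using assms by (rule someI)
  then show ?thesis unfolding par_def using sub assms by blast
qed

text \<open>\<open>df\<close> and \<open>Hf\<close> stand for the gradient and the Hessian of the smooth part.\<close>

definition newton_direction ::
  "('a::real_inner \<Rightarrow> 'a) \<Rightarrow> ('a \<Rightarrow> 'a \<Rightarrow>\<^sub>L 'a) \<Rightarrow> ('a \<Rightarrow> ereal) \<Rightarrow> 'a \<Rightarrow> 'a \<Rightarrow> 'a \<Rightarrow> bool" where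
  "newton_direction df Hf g y z d \<longleftrightarrow>
     is_arg_min (\<lambda>d. 1/2 * (blinfun_apply (Hf y) d \<bullet> d) - (z + df y) \<bullet> d)
       (\<lambda>d. d \<in> par (subdifferential (conjugate g) z)) d"

definition admissible_pair ::
  "('a::real_inner \<Rightarrow> 'a) \<Rightarrow> ('a \<Rightarrow> ereal) \<Rightarrow> 'a \<Rightarrow> real \<Rightarrow> 'a \<Rightarrow> 'a \<Rightarrow> 'a \<Rightarrow> bool" where
  "admissible_pair df g xbar \<eta> x y z \<longleftrightarrow>
     z \<in> subdifferential g y \<and>
     norm (z - (- df xbar)) + norm (y - xbar) \<le> \<eta> * norm (x - xbar)"

text \<open>Only iterations \<open>0, \<dots>, n - 1\<close> are constrained. In particular a run of length \<open>n\<close> says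
  nothing about \<open>d n\<close>, so solvability of the subproblem in iteration \<open>n\<close> can be claimed for it.\<close>

definition newton_run ::
  "('a::real_inner \<Rightarrow> 'a) \<Rightarrow> ('a \<Rightarrow> 'a \<Rightarrow>\<^sub>L 'a) \<Rightarrow> ('a \<Rightarrow> ereal) \<Rightarrow> 'a \<Rightarrow> real \<Rightarrow>
     nat \<Rightarrow> (nat \<Rightarrow> 'a) \<Rightarrow> (nat \<Rightarrow> 'a) \<Rightarrow> (nat \<Rightarrow> 'a) \<Rightarrow> (nat \<Rightarrow> 'a) \<Rightarrow> bool" where
  "newton_run df Hf g xbar \<eta> n x y z d \<longleftrightarrow>
     (\<forall>k<n. admissible_pair df g xbar \<eta> (x k) (y k) (z k) \<and>
            newton_direction df Hf g (y k) (z k) (d k) \<and>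
            x (Suc k) = y k - d k)"

lemma subdifferential_conjugateI:
  assumes "z \<in> subdifferential g x"
  shows "x \<in> subdifferential (conjugate g) z"
proof -
  obtain a where a: "g x = ereal a" using assms by (cases "g x") (auto simp: subdifferential_def)
  have sub: "ereal (a + z \<bullet> (y - x)) \<le> g y" for y
    using assms a by (auto simp: subdifferential_def)
  have "conjugate g z \<le> ereal (z \<bullet> x - a)"
    unfolding conjugate_def
  proof (rule SUP_least)
    fix y show "ereal (z \<bullet> y) - g y \<le> ereal (z \<bullet> x - a)"
      using sub[of y] by (cases "g y") (auto simp: inner_diff_right)
  qed
  moreover have ge: "ereal (v \<bullet> x - a) \<le> conjugate g v" for v
    unfolding conjugate_def by (rule SUP_upper2[of x]) (auto simp: a)
  ultimately have eq: "conjugate g z = ereal (z \<bullet> x - a)" by (meson antisym)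
  have "conjugate g z + ereal (x \<bullet> (v - z)) \<le> conjugate g v" for v
    using ge[of v] by (simp add: eq inner_diff_right inner_commute)
  then show ?thesis by (simp add: subdifferential_def eq)
qed

lemma subdifferential_conjugateD:
  fixes g :: "'a::euclidean_space \<Rightarrow> ereal"
  assumes "proper g" "convex_polyhedral g" "s \<in> subdifferential (conjugate g) z"
  shows "z \<in> subdifferential g s"
proof -
  obtain p where p: "conjugate g z = ereal p"
    using assms(3) by (cases "conjugate g z") (auto simp: subdifferential_def)
  have sub: "ereal (p + s \<bullet> (v - z)) \<le> conjugate g v" for v
    using assms(3) p by (auto simp: subdifferential_def)
  have ninf: "g y \<noteq> - \<infinity>" for y using assms(1) by (auto simp: proper_def)
  have up: "ereal (z \<bullet> y - p) \<le> g y" for y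
  proof -
    have "ereal (z \<bullet> y) - g y \<le> ereal p"
      unfolding p[symmetric] conjugate_def by (rule SUP_upper) simp
    then show ?thesis using ninf[of y] by (cases "g y") auto
  qed
  have le: "g s \<le> ereal (z \<bullet> s - p)"
  proof (rule ccontr)
    assume "\<not> ?thesis"
    then have "(s, z \<bullet> s - p) \<notin> ereal_epigraph g" by (simp add: ereal_epigraph_def)
    moreover obtain F where F: "ereal_epigraph g = \<Inter> F"
        "\<And>h. h \<in> F \<Longrightarrow> \<exists>a b. a \<noteq> 0 \<and> h = {x. a \<bullet> x \<le> b}"
      using assms(2) unfolding convex_polyhedral_def polyhedron_def by metis
    ultimately obtain h where "h \<in> F" and hs: "(s, z \<bullet> s - p) \<notin> h" by auto
    then obtain ab c where h: "h = {x. ab \<bullet> x \<le> c}" using F(2) by blast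
    obtain a b where ab: "ab = (a, b)" by (cases ab)
    have gt: "a \<bullet> s + b * (z \<bullet> s - p) > c" using hs by (simp add: h ab inner_prod_def)
    have half: "a \<bullet> x + b * r \<le> c" if "g x \<le> ereal r" for x r
    proof -
      have "(x, r) \<in> h" using that F(1) \<open>h \<in> F\<close> by (auto simp: ereal_epigraph_def)
      then show ?thesis by (simp add: h ab inner_prod_def)
    qed
    obtain x0 r0 where x0: "g x0 = ereal r0"
      using assms(1) unfolding proper_def by (metis ereal_cases)
    have "b \<le> 0"
    proof (rule ccontr)
      assume "\<not> b \<le> 0"
      define r where "r = max r0 ((c - a \<bullet> x0) / b + 1)"
      have "a \<bullet> x0 + b * r \<le> c" by (rule half) (simp add: x0 r_def)
      moreover have "b * r \<ge> b * ((c - a \<bullet> x0) / b + 1)"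
        using \<open>\<not> b \<le> 0\<close> by (intro mult_left_mono) (auto simp: r_def)
      moreover have "b * ((c - a \<bullet> x0) / b + 1) = c - a \<bullet> x0 + b"
        using \<open>\<not> b \<le> 0\<close> by (simp add: field_simps)
      ultimately show False using \<open>\<not> b \<le> 0\<close> by linarith
    qed
    have conj_le: "conjugate g v \<le> ereal q" if "\<And>x r. g x = ereal r \<Longrightarrow> v \<bullet> x - r \<le> q" for v q
      unfolding conjugate_def
    proof (rule SUP_least)
      fix x show "ereal (v \<bullet> x) - g x \<le> ereal q"
        using that[of x] ninf[of x] by (cases "g x") auto
    qed
    show False
    proof (cases "b = 0")
      case True
      have "conjugate g (z + a) \<le> ereal (p + c)"
      proof (rule conj_le)
        fix x r assume "g x = ereal r"
        then show "(z + a) \<bullet> x - r \<le> p + c"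
          using up[of x] half[of x r] True by (simp add: inner_add_left)
      qed
      then have "ereal (p + s \<bullet> (z + a - z)) \<le> ereal (p + c)" using sub order_trans by blast
      then show False using gt True by (simp add: inner_commute)
    next
      case False
      with \<open>b \<le> 0\<close> have "b < 0" by simp
      define v where "v = (1 / - b) *\<^sub>R a"
      have "conjugate g v \<le> ereal (c / - b)"
      proof (rule conj_le)
        fix x r assume "g x = ereal r"
        then have "a \<bullet> x + b * r \<le> c" using half[of x r] by simp
        then have "(a \<bullet> x + b * r) / - b \<le> c / - b"
          using \<open>b < 0\<close> by (intro divide_right_mono) auto
        moreover have "(a \<bullet> x + b * r) / - b = v \<bullet> x - r"
          using \<open>b < 0\<close> by (simp add: v_def field_simps)
        ultimately show "v \<bullet> x - r \<le> c / - b" by simp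
      qed
      then have "ereal (p + s \<bullet> (v - z)) \<le> ereal (c / - b)" using sub order_trans by blast
      then have 1: "p + v \<bullet> s - z \<bullet> s \<le> c / - b" by (simp add: inner_diff_right inner_commute)
      have "(p + v \<bullet> s - z \<bullet> s) * - b \<le> c / - b * - b"
        using 1 \<open>b < 0\<close> by (intro mult_right_mono) auto
      moreover have "v \<bullet> s * - b = a \<bullet> s" using \<open>b < 0\<close> by (simp add: v_def)
      ultimately show False using gt \<open>b < 0\<close> by (simp add: algebra_simps)
    qed
  qed
  then obtain a where a: "g s = ereal a" using ninf[of s] by (cases "g s") auto
  have "g s + ereal (z \<bullet> (y - s)) \<le> g y" for y
    using le up[of y] by (cases "g y") (auto simp: a inner_diff_right)
  then show ?thesis by (simp add: subdifferential_def a)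
qed

lemma convex_subdifferential: "convex (subdifferential h z)"
proof (cases "\<bar>h z\<bar> = \<infinity>")
  case False
  then obtain p where p: "h z = ereal p" by auto
  have "convex {s. ereal (p + s \<bullet> (v - z)) \<le> h v}" for v
  proof (cases "h v")
    case (real q)
    then have "{s. ereal (p + s \<bullet> (v - z)) \<le> h v} = {s. (v - z) \<bullet> s \<le> q - p}"
      by (auto simp: inner_commute)
    then show ?thesis by (simp add: convex_halfspace_le)
  qed auto
  then have "convex (\<Inter>v. {s. ereal (p + s \<bullet> (v - z)) \<le> h v})" by (intro convex_INT) auto
  moreover have "subdifferential h z = (\<Inter>v. {s. ereal (p + s \<bullet> (v - z)) \<le> h v})"
    by (auto simp: subdifferential_def p)
  ultimately show ?thesis by simp
qed (simp add: subdifferential_def)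

lemma directional_limit:
  fixes F :: "'a::real_normed_vector \<Rightarrow> 'b::real_normed_vector"
  assumes "(F has_derivative D) (at x)"
  shows "((\<lambda>t. (1 / t) *\<^sub>R (F (x + t *\<^sub>R w) - F x)) \<longlongrightarrow> D w) (at_right 0)"
proof -
  interpret D: bounded_linear D using assms by (rule has_derivative_bounded_linear)
  have 1: "((\<lambda>t. x + t *\<^sub>R w) has_derivative (\<lambda>t. t *\<^sub>R w)) (at 0)"
    by (auto intro!: derivative_eq_intros)
  have "((\<lambda>t. F (x + t *\<^sub>R w)) has_derivative (\<lambda>t. D (t *\<^sub>R w))) (at 0)"
    using has_derivative_compose[OF 1, of F D] assms by simp
  then have "((\<lambda>t. F (x + t *\<^sub>R w)) has_derivative (\<lambda>t. D (t *\<^sub>R w))) (at_right 0)"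
    by (rule has_derivative_at_withinI)
  then have "((\<lambda>t. (1 / norm (t - 0)) *\<^sub>R (F (x + t *\<^sub>R w) - (F (x + 0 *\<^sub>R w) + D ((t - 0) *\<^sub>R w))))
      \<longlongrightarrow> 0) (at_right 0)"
    unfolding has_derivative_within by blast
  then have "((\<lambda>t. (1 / t) *\<^sub>R (F (x + t *\<^sub>R w) - F x) - D w) \<longlongrightarrow> 0) (at_right 0)"
    by (rule Lim_transform_eventually)
       (auto simp: eventually_at_right_field D.scaleR algebra_simps intro!: exI[of _ 1])
  then show ?thesis by (simp add: LIM_zero_iff)
qed

lemma convex_gradient_ineq:
  fixes f :: "'a::real_inner \<Rightarrow> real"
  assumes "convex_on UNIV f" "GDERIV f x :> v"
  shows "f x + v \<bullet> (y - x) \<le> f y"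
proof -
  have "((\<lambda>t. (1 / t) *\<^sub>R (f (x + t *\<^sub>R (y - x)) - f x)) \<longlongrightarrow> (y - x) \<bullet> v) (at_right 0)"
    using directional_limit assms(2) unfolding gderiv_def by blast
  moreover have "\<forall>\<^sub>F t in at_right 0. (1 / t) *\<^sub>R (f (x + t *\<^sub>R (y - x)) - f x) \<le> f y - f x"
    unfolding eventually_at_right_field
  proof (intro exI[of _ "1::real"] conjI allI impI)
    fix t :: real assume t: "0 < t" "t < 1"
    have "f ((1 - t) *\<^sub>R x + t *\<^sub>R y) \<le> (1 - t) * f x + t * f y"
      using assms(1) t by (intro convex_onD) auto
    moreover have "(1 - t) *\<^sub>R x + t *\<^sub>R y = x + t *\<^sub>R (y - x)" by (simp add: algebra_simps)
    ultimately show "(1 / t) *\<^sub>R (f (x + t *\<^sub>R (y - x)) - f x) \<le> f y - f x"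
      using t by (simp add: field_simps)
  qed simp
  ultimately have "(y - x) \<bullet> v \<le> f y - f x" by (rule tendsto_upperbound) simp
  then show ?thesis by (simp add: inner_commute)
qed

text \<open>Tilt stability is usually defined through the argmin mapping \<open>m\<close> of the tilted problems
  localized to a ball. For \<open>f + g\<close> it implies the two conditions by which the main theorem
  expresses it, so the theorem applies to every tilt stable minimizer.\<close>

definition tilt_stable_minimizer :: "('a::real_inner \<Rightarrow> ereal) \<Rightarrow> 'a \<Rightarrow> bool" where
  "tilt_stable_minimizer \<phi> xbar \<longleftrightarrow> \<bar>\<phi> xbar\<bar> \<noteq> \<infinity> \<and>
     (\<exists>\<gamma>>0. \<exists>\<delta>>0. \<exists>\<kappa> m. m 0 = xbar \<and> \<kappa>-lipschitz_on (ball 0 \<delta>) m \<and>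
        (\<forall>v\<in>ball 0 \<delta>. {x. is_arg_min (\<lambda>x. \<phi> x - ereal (v \<bullet> x)) (\<lambda>x. x \<in> cball xbar \<gamma>) x} = {m v}))"

lemma tilt_stable_minimizer_imp:
  fixes f :: "'a::euclidean_space \<Rightarrow> real" and Hf :: "'a \<Rightarrow> 'a \<Rightarrow>\<^sub>L 'a"
  assumes convf: "convex_on UNIV f"
    and df: "\<And>x. GDERIV f x :> df x"
    and Hf: "\<And>x. (df has_derivative blinfun_apply (Hf x)) (at x)"
    and cont: "continuous_on UNIV Hf"
    and pr: "proper g" and poly: "convex_polyhedral g"
    and tilt: "tilt_stable_minimizer (\<lambda>x. ereal (f x) + g x) xbar"
  shows "- df xbar \<in> subdifferential g xbar"
    and "{w. blinfun_apply (Hf xbar) w = 0} \<inter>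
      par (subdifferential (conjugate g) (- df xbar)) = {0}"
proof -
  define zbar where "zbar = - df xbar"
  define S where "S = subdifferential (conjugate g) zbar"
  have ninf: "g y \<noteq> - \<infinity>" for y using pr by (auto simp: proper_def)
  obtain \<gamma> \<delta> \<kappa> m where pos: "\<gamma> > 0" "\<delta> > 0" and m0: "m 0 = xbar"
    and lip: "\<kappa>-lipschitz_on (ball 0 \<delta>) m"
    and m: "\<And>v. v \<in> ball 0 \<delta> \<Longrightarrow> {x. is_arg_min (\<lambda>x. ereal (f x) + g x - ereal (v \<bullet> x))
        (\<lambda>x. x \<in> cball xbar \<gamma>) x} = {m v}"
    using tilt unfolding tilt_stable_minimizer_def by blast
  obtain a where a: "g xbar = ereal a"
    using tilt unfolding tilt_stable_minimizer_def by (cases "g xbar") auto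
  have convg: "g ((1 - t) *\<^sub>R x + t *\<^sub>R y) \<le> ereal ((1 - t) * r + t * q)"
    if "g x \<le> ereal r" "g y \<le> ereal q" "0 \<le> t" "t \<le> 1" for x y r q t
  proof -
    have "convex (ereal_epigraph g)"
      using poly unfolding convex_polyhedral_def by (rule polyhedron_imp_convex)
    moreover have "(x, r) \<in> ereal_epigraph g" "(y, q) \<in> ereal_epigraph g"
      using that by (auto simp: ereal_epigraph_def)
    ultimately have "(1 - t) *\<^sub>R (x, r) + t *\<^sub>R (y, q) \<in> ereal_epigraph g"
      using that by (intro convexD) auto
    then show ?thesis by (simp add: ereal_epigraph_def)
  qed
  have min: "ereal (f xbar) + g xbar \<le> ereal (f y) + g y" if "y \<in> cball xbar \<gamma>" for y
  proof -
    have "xbar \<in> {x. is_arg_min (\<lambda>x. ereal (f x) + g x - ereal (0 \<bullet> x)) (\<lambda>x. x \<in> cball xbar \<gamma>) x}"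
      using m[of 0] m0 pos by simp
    then show ?thesis using that by (auto simp: is_arg_min_def zero_ereal_def[symmetric] not_less)
  qed
  have "g xbar + ereal (zbar \<bullet> (y - xbar)) \<le> g y" for y
  proof (cases "g y")
    case (real b)
    have "((\<lambda>t. (1 / t) *\<^sub>R (f (xbar + t *\<^sub>R (y - xbar)) - f xbar)) \<longlongrightarrow> (y - xbar) \<bullet> df xbar) (at_right 0)"
      using directional_limit df unfolding gderiv_def by blast
    moreover have "\<forall>\<^sub>F t in at_right 0. a - b \<le> (1 / t) *\<^sub>R (f (xbar + t *\<^sub>R (y - xbar)) - f xbar)"
      unfolding eventually_at_right_field
    proof (intro exI[of _ "min 1 (\<gamma> / (norm (y - xbar) + 1))"] conjI allI impI)
      have np: "norm (y - xbar) + 1 > 0" by (simp add: add_nonneg_pos)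
      show "0 < min 1 (\<gamma> / (norm (y - xbar) + 1))" using pos np by simp
      fix t :: real assume t: "0 < t" "t < min 1 (\<gamma> / (norm (y - xbar) + 1))"
      have "t * (norm (y - xbar) + 1) < \<gamma>" using t np by (simp add: field_simps)
      then have "t * norm (y - xbar) \<le> \<gamma>" using t by (simp add: algebra_simps)
      then have "xbar + t *\<^sub>R (y - xbar) \<in> cball xbar \<gamma>" using t by (simp add: dist_norm)
      from min[OF this] have "ereal (f xbar + a) \<le> ereal (f (xbar + t *\<^sub>R (y - xbar))) + g (xbar + t *\<^sub>R (y - xbar))"
        by (simp add: a)
      also have "g (xbar + t *\<^sub>R (y - xbar)) \<le> ereal ((1 - t) * a + t * b)"
        using convg[of xbar a y b t] t by (simp add: a real algebra_simps)
      finally have "f xbar + a \<le> f (xbar + t *\<^sub>R (y - xbar)) + ((1 - t) * a + t * b)"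
        by (simp add: add_left_mono)
      then have "t * (a - b) \<le> f (xbar + t *\<^sub>R (y - xbar)) - f xbar" by (simp add: algebra_simps)
      then show "a - b \<le> (1 / t) *\<^sub>R (f (xbar + t *\<^sub>R (y - xbar)) - f xbar)"
        using t by (simp add: field_simps)
    qed
    ultimately have "a - b \<le> (y - xbar) \<bullet> df xbar" by (rule tendsto_lowerbound) simp
    then show ?thesis by (simp add: a real zbar_def inner_commute)
  qed (use ninf in auto)
  then have zbar: "zbar \<in> subdifferential g xbar" by (simp add: subdifferential_def a)
  then show "- df xbar \<in> subdifferential g xbar" by (simp add: zbar_def)
  have xS: "xbar \<in> S" unfolding S_def using zbar by (rule subdifferential_conjugateI)
  have "isCont df xbar" using Hf has_derivative_continuous by blast
  then obtain \<rho>0 where "\<rho>0 > 0" "\<And>x. dist x xbar < \<rho>0 \<Longrightarrow> dist (df x) (df xbar) < \<delta>"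
    using pos unfolding continuous_at_eps_delta by blast
  then obtain \<rho> where \<rho>: "\<rho> > 0" "\<rho> \<le> \<gamma>" "\<And>x. dist x xbar < \<rho> \<Longrightarrow> dist (df x) (df xbar) < \<delta>"
    using pos by (intro that[of "min \<rho>0 \<gamma>"]) auto
  have argm: "m (df x - df xbar) = x" "df x - df xbar \<in> ball 0 \<delta>"
    if "x \<in> S" "dist x xbar < \<rho>" for x
  proof -
    define v where "v = df x - df xbar"
    show vin: "df x - df xbar \<in> ball 0 \<delta>" using \<rho>(3)[OF that(2)] by (simp add: dist_norm norm_minus_commute)
    have zx: "zbar \<in> subdifferential g x"
      using subdifferential_conjugateD[OF pr poly] that(1) unfolding S_def by blast
    then obtain b where b: "g x = ereal b" by (cases "g x") (auto simp: subdifferential_def)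
    have "ereal (f x) + g x - ereal (v \<bullet> x) \<le> ereal (f y) + g y - ereal (v \<bullet> y)" for y
    proof -
      have "f x + df x \<bullet> (y - x) \<le> f y" using convf df by (rule convex_gradient_ineq)
      moreover have "ereal (b + zbar \<bullet> (y - x)) \<le> g y" using zx b by (auto simp: subdifferential_def)
      moreover have "df x \<bullet> (y - x) + zbar \<bullet> (y - x) = v \<bullet> y - v \<bullet> x"
        by (simp add: v_def zbar_def algebra_simps)
      ultimately show ?thesis using b by (cases "g y") auto
    qed
    then have "x \<in> {x. is_arg_min (\<lambda>x. ereal (f x) + g x - ereal (v \<bullet> x)) (\<lambda>x. x \<in> cball xbar \<gamma>) x}"
      using that \<rho> by (auto simp: is_arg_min_linorder dist_commute)
    then have "x \<in> {m v}" by (simp only: m[OF vin[folded v_def]])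
    then show "m (df x - df xbar) = x" by (simp add: v_def)
  qed
  have key: "norm (x - x') \<le> \<kappa> * norm (df x - df x')"
    if "x \<in> S" "dist x xbar < \<rho>" "x' \<in> S" "dist x' xbar < \<rho>" for x x'
    using lipschitz_onD[OF lip argm(2)[OF that(1,2)] argm(2)[OF that(3,4)]] argm(1) that
    by (simp add: dist_norm)
  have convS: "convex S" unfolding S_def by (rule convex_subdifferential)
  then obtain s where s: "s \<in> rel_interior S" using xS rel_interior_eq_empty by blast
  have "w = 0" if wpar: "w \<in> par S" and w0: "blinfun_apply (Hf xbar) w = 0" for w
  proof -
    define p where "p t = xbar + t *\<^sub>R (s - xbar)" for t
    have bound: "norm w \<le> \<kappa> * norm (blinfun_apply (Hf (p t)) w)"
      if t: "0 < t" "t \<le> 1" and near: "dist (p t) xbar < \<rho>" for t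
    proof -
      have "p t \<in> rel_interior S"
        using rel_interior_convex_shrink[OF convS s xS t] by (simp add: p_def algebra_simps)
      then obtain e where e: "e > 0" and pS: "p t \<in> S" and sub: "cball (p t) e \<inter> affine hull S \<subseteq> S"
        unfolding mem_rel_interior_cball by blast
      have "par S = span ((\<lambda>x. - p t + x) ` S)" using par_eq[OF pS] by simp
      then have "w \<in> span ((\<lambda>x. - p t + x) ` S)" using wpar by simp
      then have aff: "p t + \<tau> *\<^sub>R w \<in> affine hull S" for \<tau>
        using affine_hull_span_gen[of "p t" S] pS hull_inc[of "p t" S] by (auto intro: span_scale)
      define e' where "e' = min e (\<rho> - dist (p t) xbar) / (norm w + 1)"
      have np: "norm w + 1 > 0" by (simp add: add_nonneg_pos)
      have "((\<lambda>\<tau>. (1 / \<tau>) *\<^sub>R (df (p t + \<tau> *\<^sub>R w) - df (p t))) \<longlongrightarrow> blinfun_apply (Hf (p t)) w) (at_right 0)"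
        by (rule directional_limit[OF Hf])
      then have "((\<lambda>\<tau>. \<kappa> * norm ((1 / \<tau>) *\<^sub>R (df (p t + \<tau> *\<^sub>R w) - df (p t))))
          \<longlongrightarrow> \<kappa> * norm (blinfun_apply (Hf (p t)) w)) (at_right 0)"
        by (intro tendsto_intros)
      moreover have "\<forall>\<^sub>F \<tau> in at_right 0.
          norm w \<le> \<kappa> * norm ((1 / \<tau>) *\<^sub>R (df (p t + \<tau> *\<^sub>R w) - df (p t)))"
        unfolding eventually_at_right_field
      proof (intro exI[of _ e'] conjI allI impI)
        show "0 < e'" using e near np by (simp add: e'_def)
        fix \<tau> assume \<tau>: "0 < \<tau>" "\<tau> < e'"
        have "\<tau> * (norm w + 1) < min e (\<rho> - dist (p t) xbar)"
          using \<tau> np by (simp add: e'_def pos_less_divide_eq)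
        then have *: "\<tau> * norm w < min e (\<rho> - dist (p t) xbar)" using \<tau> by (simp add: algebra_simps)
        have "p t + \<tau> *\<^sub>R w \<in> S" using * sub aff[of \<tau>] \<tau> by (auto simp: dist_norm)
        moreover have "dist (p t + \<tau> *\<^sub>R w) xbar < \<rho>"
          using dist_triangle[of "p t + \<tau> *\<^sub>R w" xbar "p t"] * \<tau> by (simp add: dist_norm)
        ultimately have "norm (p t + \<tau> *\<^sub>R w - p t) \<le> \<kappa> * norm (df (p t + \<tau> *\<^sub>R w) - df (p t))"
          using key pS near by blast
        then show "norm w \<le> \<kappa> * norm ((1 / \<tau>) *\<^sub>R (df (p t + \<tau> *\<^sub>R w) - df (p t)))"
          using \<tau> by (simp add: pos_le_divide_eq mult.commute)
      qed
      ultimately show ?thesis by (rule tendsto_lowerbound) simp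
    qed
    have p0: "(p \<longlongrightarrow> xbar) (at_right 0)"
      unfolding p_def by (auto intro!: tendsto_eq_intros)
    have "isCont Hf xbar" using cont by (simp add: continuous_on_eq_continuous_at)
    then have "((\<lambda>t. Hf (p t)) \<longlongrightarrow> Hf xbar) (at_right 0)"
      using p0 by (rule isCont_tendsto_compose)
    then have "((\<lambda>t. \<kappa> * norm (blinfun_apply (Hf (p t)) w)) \<longlongrightarrow> \<kappa> * norm (blinfun_apply (Hf xbar) w)) (at_right 0)"
      by (intro tendsto_intros)
    moreover have "\<forall>\<^sub>F t in at_right 0. norm w \<le> \<kappa> * norm (blinfun_apply (Hf (p t)) w)"
    proof -
      have "\<forall>\<^sub>F t in at_right 0. dist (p t) xbar < \<rho>" using p0 \<rho>(1) by (rule tendstoD)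
      moreover have "\<forall>\<^sub>F t in at_right 0. 0 < t \<and> t \<le> (1::real)"
        unfolding eventually_at_right_field by (intro exI[of _ 1]) auto
      ultimately show ?thesis by eventually_elim (use bound in auto)
    qed
    ultimately have "norm w \<le> \<kappa> * norm (blinfun_apply (Hf xbar) w)" by (rule tendsto_lowerbound) simp
    then show "w = 0" by (simp add: w0)
  qed
  moreover have "0 \<in> par S" unfolding par_def by (rule span_zero)
  ultimately show "{w. blinfun_apply (Hf xbar) w = 0} \<inter>
      par (subdifferential (conjugate g) (- df xbar)) = {0}"
    by (auto simp: S_def zbar_def)
qed

end

theory Submission
  imports Defs
begin

text \<open>Write \<open>H\<close> for the Hessian, \<open>S(z) = \<partial>g\<^sup>*(z)\<close> and \<open>z\<^sub>0 = -\<nabla>f(xbar)\<close>, where \<open>xbar\<close> is the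
  solution. By duality \<open>x \<in> S(z)\<close> holds iff \<open>z \<in> \<partial>g(x)\<close>.

  Since the epigraph of \<open>g\<close> is a polyhedron, there are only finitely many different sets \<open>S(z)\<close>.
  All of them are closed, and so are the sets of those \<open>z\<close> for which \<open>S(z)\<close> contains a given set.
  Hence for \<open>z \<in> \<partial>g(y)\<close> with \<open>(y, z)\<close> close to \<open>(xbar, z\<^sub>0)\<close> both \<open>xbar \<in> S(z)\<close> and
  \<open>S(z) \<subseteq> S(z\<^sub>0)\<close> (\<open>subdifferential_conjugate_locally_contained\<close>). With \<open>L = par S(z)\<close> this has three
  consequences: \<open>y - xbar \<in> L\<close>; the slopes \<open>z\<close> and \<open>z\<^sub>0\<close> agree on \<open>L\<close>
  (\<open>subgradient_diff_orthogonal_par\<close>); and \<open>L \<subseteq> par S(z\<^sub>0)\<close>.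

  The Hessian is symmetric and positive semidefinite, so the kernel condition makes \<open>H(xbar)\<close>
  coercive on \<open>par S(z\<^sub>0)\<close>, and by continuity \<open>H(y)\<close> is coercive there, and a fortiori on \<open>L\<close>, with
  a constant \<open>c\<close> independent of \<open>y\<close> and \<open>z\<close>. The quadratic program on \<open>L\<close> therefore has a unique
  solution \<open>d\<close>, characterized by
  \<open>H(y) d \<bullet> l = (z + \<nabla>f(y)) \<bullet> l = (\<nabla>f(y) - \<nabla>f(xbar)) \<bullet> l\<close> for \<open>l \<in> L\<close>.

  The new error is \<open>-e\<close> with \<open>e = d - (y - xbar) \<in> L\<close>. Taking \<open>l = e\<close> gives
  \<open>c |e|\<^sup>2 \<le> H(y) e \<bullet> e = (\<nabla>f(y) - \<nabla>f(xbar) - H(y) (y - xbar)) \<bullet> e\<close>, and the bracket is of order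
  \<open>|y - xbar|\<^sup>2\<close> by the Lipschitz continuity of \<open>H\<close> (\<open>newton_step_local\<close>). As \<open>|y - xbar|\<close> is at
  most \<open>\<eta>\<close> times the old error, the error contracts quadratically.\<close>

section \<open>Hessians of convex functions\<close>

text \<open>Two applications of the mean value theorem, first in the direction \<open>u\<close> and then in \<open>v\<close>.
  Symmetry of the left-hand side in \<open>u\<close> and \<open>v\<close> yields symmetry of the Hessian in the limit.\<close>

lemma second_difference_eq_hessian:
  fixes f :: "'a::real_inner \<Rightarrow> real" and Hf :: "'a \<Rightarrow> 'a \<Rightarrow>\<^sub>L 'a"
  assumes df: "\<And>x. GDERIV f x :> df x"
    and Hf: "\<And>x. (df has_derivative blinfun_apply (Hf x)) (at x)"
    and t: "t > 0"
  obtains p where "norm (p - x) \<le> t * (norm u + norm v)"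
    "f (x + t *\<^sub>R u + t *\<^sub>R v) - f (x + t *\<^sub>R u) - f (x + t *\<^sub>R v) + f x =
       t\<^sup>2 * (blinfun_apply (Hf p) v \<bullet> u)"
proof -
  define \<phi> where "\<phi> s = f (x + s *\<^sub>R u + t *\<^sub>R v) - f (x + s *\<^sub>R u)" for s
  have line: "((\<lambda>s. c + s *\<^sub>R w) has_derivative (\<lambda>s. s *\<^sub>R w)) (at s)" for c w :: 'a and s
    by (auto intro!: derivative_eq_intros)
  have fd: "((\<lambda>s. f (c + s *\<^sub>R u)) has_real_derivative df (c + s *\<^sub>R u) \<bullet> u) (at s)" for c s
  proof -
    from has_derivative_compose[OF line df[unfolded gderiv_def], of c u s]
    show ?thesis
      by (simp add: has_field_derivative_def inner_commute mult_commute_abs)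
  qed
  have "(\<phi> has_real_derivative (df (x + s *\<^sub>R u + t *\<^sub>R v) - df (x + s *\<^sub>R u)) \<bullet> u) (at s)" for s
    unfolding \<phi>_def
    using DERIV_diff[OF fd[of "x + t *\<^sub>R v" s] fd[of x s]] by (simp add: inner_diff_left add_ac)
  then obtain \<xi> where \<xi>: "0 < \<xi>" "\<xi> < t"
    "\<phi> t - \<phi> 0 = (t - 0) * ((df (x + \<xi> *\<^sub>R u + t *\<^sub>R v) - df (x + \<xi> *\<^sub>R u)) \<bullet> u)"
    using MVT2[OF t, of \<phi> "\<lambda>s. (df (x + s *\<^sub>R u + t *\<^sub>R v) - df (x + s *\<^sub>R u)) \<bullet> u"] by auto
  define \<psi> where "\<psi> s = df (x + \<xi> *\<^sub>R u + s *\<^sub>R v) \<bullet> u" for s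
  have "(\<psi> has_real_derivative blinfun_apply (Hf (x + \<xi> *\<^sub>R u + s *\<^sub>R v)) v \<bullet> u) (at s)" for s
  proof -
    have "((\<lambda>h. df (x + \<xi> *\<^sub>R u + h *\<^sub>R v)) has_derivative
        (\<lambda>h. blinfun_apply (Hf (x + \<xi> *\<^sub>R u + s *\<^sub>R v)) (h *\<^sub>R v))) (at s)"
      by (rule has_derivative_compose[OF line Hf])
    then have "((\<lambda>h. df (x + \<xi> *\<^sub>R u + h *\<^sub>R v) \<bullet> u) has_derivative
        (\<lambda>h. blinfun_apply (Hf (x + \<xi> *\<^sub>R u + s *\<^sub>R v)) (h *\<^sub>R v) \<bullet> u)) (at s)"
      by (rule has_derivative_inner_left)
    then show ?thesis
      unfolding \<psi>_def has_field_derivative_def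
      by (simp only: blinfun.scaleR_right inner_scaleR_left mult_commute_abs)
  qed
  then obtain \<tau> where \<tau>: "0 < \<tau>" "\<tau> < t"
    "\<psi> t - \<psi> 0 = (t - 0) * (blinfun_apply (Hf (x + \<xi> *\<^sub>R u + \<tau> *\<^sub>R v)) v \<bullet> u)"
    using MVT2[OF t, of \<psi> "\<lambda>s. blinfun_apply (Hf (x + \<xi> *\<^sub>R u + s *\<^sub>R v)) v \<bullet> u"] by auto
  show thesis
  proof
    have "norm (\<xi> *\<^sub>R u + \<tau> *\<^sub>R v) \<le> \<xi> * norm u + \<tau> * norm v"
      using norm_triangle_ineq[of "\<xi> *\<^sub>R u" "\<tau> *\<^sub>R v"] \<xi> \<tau> by simp
    also have "\<dots> \<le> t * norm u + t * norm v"
      using \<xi> \<tau> by (intro add_mono mult_right_mono) auto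
    finally show "norm (x + \<xi> *\<^sub>R u + \<tau> *\<^sub>R v - x) \<le> t * (norm u + norm v)"
      by (simp add: algebra_simps)
    have "f (x + t *\<^sub>R u + t *\<^sub>R v) - f (x + t *\<^sub>R u) - f (x + t *\<^sub>R v) + f x = \<phi> t - \<phi> 0"
      by (simp add: \<phi>_def)
    also have "\<dots> = t * (\<psi> t - \<psi> 0)"
      using \<xi>(3) by (simp add: \<psi>_def inner_diff_left)
    finally show "f (x + t *\<^sub>R u + t *\<^sub>R v) - f (x + t *\<^sub>R u) - f (x + t *\<^sub>R v) + f x =
       t\<^sup>2 * (blinfun_apply (Hf (x + \<xi> *\<^sub>R u + \<tau> *\<^sub>R v)) v \<bullet> u)"
      using \<tau>(3) by (simp add: power2_eq_square)
  qed
qed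

lemma hessian_symmetric:
  fixes f :: "'a::real_inner \<Rightarrow> real" and Hf :: "'a \<Rightarrow> 'a \<Rightarrow>\<^sub>L 'a"
  assumes df: "\<And>x. GDERIV f x :> df x"
    and Hf: "\<And>x. (df has_derivative blinfun_apply (Hf x)) (at x)"
    and cont: "isCont Hf x"
  shows "blinfun_apply (Hf x) u \<bullet> v = u \<bullet> blinfun_apply (Hf x) v"
proof -
  have "\<exists>p q. norm (p - x) \<le> t * (norm u + norm v) \<and> norm (q - x) \<le> t * (norm u + norm v) \<and>
      blinfun_apply (Hf p) v \<bullet> u = blinfun_apply (Hf q) u \<bullet> v" if t: "t > 0" for t
  proof -
    obtain p where p: "norm (p - x) \<le> t * (norm u + norm v)"
      "f (x + t *\<^sub>R u + t *\<^sub>R v) - f (x + t *\<^sub>R u) - f (x + t *\<^sub>R v) + f x =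
       t\<^sup>2 * (blinfun_apply (Hf p) v \<bullet> u)"
      using second_difference_eq_hessian[OF df Hf t] by blast
    obtain q where q: "norm (q - x) \<le> t * (norm v + norm u)"
      "f (x + t *\<^sub>R v + t *\<^sub>R u) - f (x + t *\<^sub>R v) - f (x + t *\<^sub>R u) + f x =
       t\<^sup>2 * (blinfun_apply (Hf q) u \<bullet> v)"
      using second_difference_eq_hessian[OF df Hf t] by blast
    have "t\<^sup>2 * (blinfun_apply (Hf p) v \<bullet> u) = t\<^sup>2 * (blinfun_apply (Hf q) u \<bullet> v)"
      unfolding p(2)[symmetric] q(2)[symmetric] by (simp add: add_ac)
    then show ?thesis using p(1) q(1) t by (intro exI[of _ p] exI[of _ q]) (simp add: add_ac)
  qed
  then obtain p q where
    p: "\<And>t. t > 0 \<Longrightarrow> norm (p t - x) \<le> t * (norm u + norm v)" and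
    q: "\<And>t. t > 0 \<Longrightarrow> norm (q t - x) \<le> t * (norm u + norm v)" and
    eq: "\<And>t. t > 0 \<Longrightarrow> blinfun_apply (Hf (p t)) v \<bullet> u = blinfun_apply (Hf (q t)) u \<bullet> v"
    by metis
  have lim0: "((\<lambda>t. t * (norm u + norm v)) \<longlongrightarrow> 0) (at_right 0)"
    by (auto intro!: tendsto_eq_intros)
  have lim: "(r \<longlongrightarrow> x) (at_right 0)"
    if "\<And>t. t > 0 \<Longrightarrow> norm (r t - x) \<le> t * (norm u + norm v)" for r :: "real \<Rightarrow> 'a"
  proof (rule LIM_zero_cancel, rule Lim_null_comparison[OF _ lim0])
    show "\<forall>\<^sub>F t in at_right 0. norm (r t - x) \<le> t * (norm u + norm v)"
      using that by (auto simp: eventually_at_right_field intro: exI[of _ 1])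
  qed
  have "((\<lambda>t. blinfun_apply (Hf (p t)) v \<bullet> u) \<longlongrightarrow> blinfun_apply (Hf x) v \<bullet> u) (at_right 0)"
    by (intro tendsto_intros isCont_tendsto_compose[OF cont] lim p)
  moreover have "\<forall>\<^sub>F t in at_right 0.
      blinfun_apply (Hf (p t)) v \<bullet> u = blinfun_apply (Hf (q t)) u \<bullet> v"
    using eq by (auto simp: eventually_at_right_field intro: exI[of _ 1])
  ultimately have "((\<lambda>t. blinfun_apply (Hf (q t)) u \<bullet> v) \<longlongrightarrow> blinfun_apply (Hf x) v \<bullet> u) (at_right 0)"
    by (rule Lim_transform_eventually)
  moreover have "((\<lambda>t. blinfun_apply (Hf (q t)) u \<bullet> v) \<longlongrightarrow> blinfun_apply (Hf x) u \<bullet> v) (at_right 0)"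
    by (intro tendsto_intros isCont_tendsto_compose[OF cont] lim q)
  ultimately have "blinfun_apply (Hf x) v \<bullet> u = blinfun_apply (Hf x) u \<bullet> v"
    using tendsto_unique[OF trivial_limit_at_right_real] by blast
  then show ?thesis by (simp add: inner_commute)
qed

lemma convex_hessian_nonneg:
  fixes f :: "'a::real_inner \<Rightarrow> real" and Hf :: "'a \<Rightarrow> 'a \<Rightarrow>\<^sub>L 'a"
  assumes conv: "convex_on UNIV f"
    and df: "\<And>x. GDERIV f x :> df x"
    and Hf: "(df has_derivative blinfun_apply (Hf x)) (at x)"
  shows "0 \<le> blinfun_apply (Hf x) w \<bullet> w"
proof -
  have "((\<lambda>t. (1 / t) *\<^sub>R (df (x + t *\<^sub>R w) - df x) \<bullet> w) \<longlongrightarrow> blinfun_apply (Hf x) w \<bullet> w) (at_right 0)"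
    by (intro tendsto_intros directional_limit[OF Hf])
  moreover have "\<forall>\<^sub>F t in at_right 0. 0 \<le> (1 / t) *\<^sub>R (df (x + t *\<^sub>R w) - df x) \<bullet> w"
    unfolding eventually_at_right_field
  proof (intro exI[of _ "1::real"] conjI allI impI)
    fix t :: real assume t: "0 < t" "t < 1"
    have "0 \<le> (df (x + t *\<^sub>R w) - df x) \<bullet> (t *\<^sub>R w)"
      using convex_gradient_ineq[OF conv df, of x "x + t *\<^sub>R w"]
        convex_gradient_ineq[OF conv df, of "x + t *\<^sub>R w" x]
      by (simp add: inner_diff_left right_diff_distrib)
    then show "0 \<le> (1 / t) *\<^sub>R (df (x + t *\<^sub>R w) - df x) \<bullet> w"
      using t by (simp add: zero_le_mult_iff)
  qed simp
  ultimately show ?thesis by (rule tendsto_lowerbound) simp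
qed

lemma linear_coeff_zero:
  fixes \<alpha> \<beta> :: real
  assumes "\<And>t. 0 \<le> t * \<alpha> + t\<^sup>2 * \<beta>" "\<beta> \<ge> 0"
  shows "\<alpha> = 0"
proof -
  define t where "t = - \<alpha> / (\<beta> + 1)"
  have "\<alpha> = - t * (\<beta> + 1)" using assms(2) by (simp add: t_def)
  then have "t * \<alpha> + t\<^sup>2 * \<beta> = - t\<^sup>2" by algebra
  then have "t = 0" using assms(1)[of t] by simp
  then show ?thesis using assms(2) by (simp add: t_def)
qed

text \<open>Symmetry cannot be dropped: a skew operator is monotone, but every vector is isotropic for it.\<close>

lemma psd_isotropic_imp_kernel:
  fixes A :: "'a::real_inner \<Rightarrow>\<^sub>L 'a"
  assumes sym: "\<And>u v. blinfun_apply A u \<bullet> v = u \<bullet> blinfun_apply A v"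
    and psd: "\<And>u. 0 \<le> blinfun_apply A u \<bullet> u"
    and w: "blinfun_apply A w \<bullet> w = 0"
  shows "blinfun_apply A w = 0"
proof -
  have "2 * (blinfun_apply A w \<bullet> v) = 0" for v
  proof (rule linear_coeff_zero)
    fix t :: real
    have "blinfun_apply A (w + t *\<^sub>R v) \<bullet> (w + t *\<^sub>R v) =
        t * (2 * (blinfun_apply A w \<bullet> v)) + t\<^sup>2 * (blinfun_apply A v \<bullet> v)"
      using sym[of v w] w
      by (simp add: blinfun.add_right blinfun.scaleR_right inner_add_left inner_add_right
          power2_eq_square inner_commute algebra_simps)
    then show "0 \<le> t * (2 * (blinfun_apply A w \<bullet> v)) + t\<^sup>2 * (blinfun_apply A v \<bullet> v)"
      using psd[of "w + t *\<^sub>R v"] by simp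
  qed (rule psd)
  from this[of "blinfun_apply A w"] show ?thesis by simp
qed

lemma coercive_on_subspace:
  fixes A :: "'a::euclidean_space \<Rightarrow>\<^sub>L 'a"
  assumes L: "subspace L"
    and pos: "\<And>w. w \<in> L \<Longrightarrow> w \<noteq> 0 \<Longrightarrow> 0 < blinfun_apply A w \<bullet> w"
  obtains c where "c > 0" "\<And>w. w \<in> L \<Longrightarrow> c * (norm w)\<^sup>2 \<le> blinfun_apply A w \<bullet> w"
proof -
  have "\<exists>c>0. \<forall>w\<in>L \<inter> sphere 0 1. c \<le> blinfun_apply A w \<bullet> w"
  proof (cases "L \<inter> sphere 0 1 = {}")
    case False
    have "compact (L \<inter> sphere 0 1)"
      using closed_subspace[OF L] by (simp add: closed_Int_compact)
    moreover have "continuous_on (L \<inter> sphere 0 1) (\<lambda>w. blinfun_apply A w \<bullet> w)"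
      by (intro continuous_intros)
    ultimately obtain m where m: "m \<in> L \<inter> sphere 0 1"
      "\<And>w. w \<in> L \<inter> sphere 0 1 \<Longrightarrow> blinfun_apply A m \<bullet> m \<le> blinfun_apply A w \<bullet> w"
      using continuous_attains_inf[OF _ False] by blast
    have "0 < blinfun_apply A m \<bullet> m" using m(1) by (intro pos) auto
    then show ?thesis using m(2) by blast
  qed (auto intro: exI[of _ 1])
  then obtain c where c: "c > 0" "\<And>w. w \<in> L \<Longrightarrow> norm w = 1 \<Longrightarrow> c \<le> blinfun_apply A w \<bullet> w"
    by auto
  have "c * (norm w)\<^sup>2 \<le> blinfun_apply A w \<bullet> w" if "w \<in> L" for w
  proof (cases "w = 0")
    case False
    have "c \<le> blinfun_apply A (w /\<^sub>R norm w) \<bullet> (w /\<^sub>R norm w)"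
      using False that L by (intro c) (auto simp: subspace_scale)
    also have "\<dots> = (blinfun_apply A w \<bullet> w) / (norm w)\<^sup>2"
      by (simp add: blinfun.scaleR_right power2_eq_square divide_inverse)
    finally show ?thesis using False by (simp add: pos_le_divide_eq)
  qed simp
  then show thesis using c(1) that by blast
qed

section \<open>Quadratic programs on a subspace\<close>

lemma quadratic_argmin_first_order:
  fixes A :: "'a::real_inner \<Rightarrow>\<^sub>L 'a"
  assumes sym: "\<And>u v. blinfun_apply A u \<bullet> v = u \<bullet> blinfun_apply A v"
    and psd: "\<And>u. 0 \<le> blinfun_apply A u \<bullet> u"
    and L: "subspace L" and l: "l \<in> L"
    and d: "is_arg_min (\<lambda>d. 1/2 * (blinfun_apply A d \<bullet> d) - b \<bullet> d) (\<lambda>d. d \<in> L) d"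
  shows "blinfun_apply A d \<bullet> l = b \<bullet> l"
proof -
  have "blinfun_apply A d \<bullet> l - b \<bullet> l = 0"
  proof (rule linear_coeff_zero)
    fix t :: real
    have "d + t *\<^sub>R l \<in> L" using d l L by (auto simp: is_arg_min_def subspace_add subspace_scale)
    then have "1/2 * (blinfun_apply A d \<bullet> d) - b \<bullet> d \<le>
        1/2 * (blinfun_apply A (d + t *\<^sub>R l) \<bullet> (d + t *\<^sub>R l)) - b \<bullet> (d + t *\<^sub>R l)"
      using d by (auto simp: is_arg_min_linorder)
    then show "0 \<le> t * (blinfun_apply A d \<bullet> l - b \<bullet> l) + t\<^sup>2 * (1/2 * (blinfun_apply A l \<bullet> l))"
      using sym[of l d]
      by (simp add: blinfun.add_right blinfun.scaleR_right inner_add_left inner_add_right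
          power2_eq_square inner_commute algebra_simps)
  qed (use psd[of l] in simp)
  then show ?thesis by simp
qed

lemma quadratic_argmin_unique:
  fixes A :: "'a::euclidean_space \<Rightarrow>\<^sub>L 'a"
  assumes sym: "\<And>u v. blinfun_apply A u \<bullet> v = u \<bullet> blinfun_apply A v"
    and psd: "\<And>u. 0 \<le> blinfun_apply A u \<bullet> u"
    and L: "subspace L"
    and c: "c > 0" "\<And>w. w \<in> L \<Longrightarrow> c * (norm w)\<^sup>2 \<le> blinfun_apply A w \<bullet> w"
  shows "\<exists>!d. is_arg_min (\<lambda>d. 1/2 * (blinfun_apply A d \<bullet> d) - b \<bullet> d) (\<lambda>d. d \<in> L) d"
proof -
  define F where "F d = 1/2 * (blinfun_apply A d \<bullet> d) - b \<bullet> d" for d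
  \<comment> \<open>Outside the ball of this radius coercivity makes \<open>F\<close> exceed \<open>F 0 = 0\<close>.\<close>
  define R where "R = 2 * norm b / c"
  have "R \<ge> 0" using c by (simp add: R_def)
  have "compact (L \<inter> cball 0 R)" using closed_subspace[OF L] by (simp add: closed_Int_compact)
  moreover have "0 \<in> L \<inter> cball 0 R" using \<open>R \<ge> 0\<close> L by (simp add: subspace_0)
  moreover have "continuous_on (L \<inter> cball 0 R) F" unfolding F_def by (intro continuous_intros)
  ultimately obtain d where d: "d \<in> L \<inter> cball 0 R" "\<And>e. e \<in> L \<inter> cball 0 R \<Longrightarrow> F d \<le> F e"
    using continuous_attains_inf by (metis empty_iff)
  have "F d \<le> F e" if "e \<in> L" for e
  proof (cases "norm e \<le> R")
    case False
    have "norm b \<le> c / 2 * norm e" using False c by (simp add: R_def field_simps)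
    then have "norm b * norm e \<le> c / 2 * norm e * norm e" by (intro mult_right_mono) auto
    also have "\<dots> \<le> 1/2 * (blinfun_apply A e \<bullet> e)"
      using c(2)[OF that] by (simp add: power2_eq_square)
    finally have "0 \<le> F e" using norm_cauchy_schwarz[of b e] by (simp add: F_def)
    moreover have "F d \<le> F 0" using d \<open>0 \<in> L \<inter> cball 0 R\<close> by blast
    ultimately show ?thesis by (simp add: F_def)
  qed (use d that in auto)
  then have ex: "is_arg_min F (\<lambda>d. d \<in> L) d" using d by (auto simp: is_arg_min_linorder)
  have "d1 = d2" if "is_arg_min F (\<lambda>d. d \<in> L) d1" "is_arg_min F (\<lambda>d. d \<in> L) d2" for d1 d2
  proof -
    have mem: "d1 - d2 \<in> L" using that L by (auto simp: is_arg_min_def subspace_diff)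
    have "blinfun_apply A d \<bullet> (d1 - d2) = b \<bullet> (d1 - d2)" if "is_arg_min F (\<lambda>d. d \<in> L) d" for d
      using quadratic_argmin_first_order[OF sym psd L mem] that unfolding F_def by blast
    then have "blinfun_apply A (d1 - d2) \<bullet> (d1 - d2) = 0"
      using that by (simp add: blinfun.diff_right inner_diff_left)
    then have "c * (norm (d1 - d2))\<^sup>2 \<le> 0" using c(2)[OF mem] by simp
    then show ?thesis using c(1) by (simp add: mult_le_0_iff)
  qed
  with ex show ?thesis unfolding F_def by blast
qed

section \<open>Subdifferentials of polyhedral functions and of their conjugates\<close>

lemma subdifferential_conjugate_iff:
  fixes g :: "'a::euclidean_space \<Rightarrow> ereal"
  assumes "proper g" "convex_polyhedral g"
  shows "x \<in> subdifferential (conjugate g) z \<longleftrightarrow> z \<in> subdifferential g x"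
  by (rule iffI) (erule subdifferential_conjugateD[OF assms], erule subdifferential_conjugateI)

lemma closed_subdifferential: "closed (subdifferential h z)"
proof (cases "\<bar>h z\<bar> = \<infinity>")
  case False
  then obtain p where p: "h z = ereal p" by auto
  have "closed {s. ereal (p + s \<bullet> (v - z)) \<le> h v}" for v
  proof (cases "h v")
    case (real q)
    then have "{s. ereal (p + s \<bullet> (v - z)) \<le> h v} = {s. (v - z) \<bullet> s \<le> q - p}"
      by (auto simp: inner_commute)
    then show ?thesis by (simp add: closed_halfspace_le)
  qed auto
  then have "closed (\<Inter>v. {s. ereal (p + s \<bullet> (v - z)) \<le> h v})" by (intro closed_INT) auto
  moreover have "subdifferential h z = (\<Inter>v. {s. ereal (p + s \<bullet> (v - z)) \<le> h v})"
    by (auto simp: subdifferential_def p)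
  ultimately show ?thesis by simp
qed (simp add: subdifferential_def)

text \<open>If \<open>x\<close> and \<open>u\<close> share the subgradient \<open>z\<close> then \<open>g\<close> agrees at both points with the
  supporting affine function of slope \<open>z\<close>.\<close>

lemma common_subgradient_inner:
  assumes "z \<in> subdifferential g x" "z \<in> subdifferential g u"
  shows "ereal (z \<bullet> (u - x)) = g u - g x"
proof -
  obtain a b where ab: "g x = ereal a" "g u = ereal b"
    using assms by (cases "g x"; cases "g u") (auto simp: subdifferential_def)
  have "g x + ereal (z \<bullet> (u - x)) \<le> g u" "g u + ereal (z \<bullet> (x - u)) \<le> g x"
    using assms by (auto simp: subdifferential_def)
  then show ?thesis using ab by (simp add: inner_diff_right)
qed

text \<open>The set \<open>\<partial>g\<^sup>*(z)\<close> is the shadow of the face of the epigraph exposed by \<open>(z, -1)\<close>, and a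
  polyhedron has finitely many faces.\<close>

lemma finite_range_subdifferential_conjugate:
  fixes g :: "'a::euclidean_space \<Rightarrow> ereal"
  assumes pr: "proper g" and poly: "convex_polyhedral g"
  shows "finite (range (subdifferential (conjugate g)))"
proof -
  let ?E = "ereal_epigraph g"
  have polyE: "polyhedron ?E" using poly by (simp add: convex_polyhedral_def)
  have "subdifferential (conjugate g) z \<in> insert {} ((`) fst ` {F. F exposed_face_of ?E})" for z
  proof (cases "subdifferential (conjugate g) z = {}")
    case False
    then obtain x where x: "z \<in> subdifferential g x"
      using subdifferential_conjugate_iff[OF pr poly] by blast
    then obtain a where a: "g x = ereal a" by (cases "g x") (auto simp: subdifferential_def)
    define c where "c = z \<bullet> x - a"
    have sub: "ereal (a + z \<bullet> (y - x)) \<le> g y" for y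
      using x a by (auto simp: subdifferential_def)
    define F where "F = ?E \<inter> {p. (z, - 1) \<bullet> p = c}"
    have "(z, - 1::real) \<bullet> p \<le> c" if "p \<in> ?E" for p
    proof -
      obtain y r where p: "p = (y, r)" by (cases p)
      then have "g y \<le> ereal r" using that by (simp add: ereal_epigraph_def)
      with sub[of y] have "ereal (a + z \<bullet> (y - x)) \<le> ereal r" by (rule order_trans)
      then show ?thesis by (simp add: p c_def inner_diff_right)
    qed
    then have "F exposed_face_of ?E"
      unfolding F_def using polyhedron_imp_convex[OF polyE]
      by (intro exposed_face_of_Int_supporting_hyperplane_le)
    moreover have "subdifferential (conjugate g) z = fst ` F"
    proof (intro equalityI subsetI)
      fix u assume "u \<in> subdifferential (conjugate g) z"
      then have u: "z \<in> subdifferential g u" using subdifferential_conjugate_iff[OF pr poly] by blast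
      then obtain b where b: "g u = ereal b" by (cases "g u") (auto simp: subdifferential_def)
      have "z \<bullet> (u - x) = b - a" using common_subgradient_inner[OF x u] a b by simp
      then have "(u, b) \<in> F" using b by (simp add: F_def ereal_epigraph_def c_def inner_diff_right)
      then show "u \<in> fst ` F" by force
    next
      fix u assume "u \<in> fst ` F"
      then obtain r where "(u, r) \<in> F" by auto
      then have r: "g u \<le> ereal r" "r = a + z \<bullet> (u - x)"
        by (auto simp: F_def ereal_epigraph_def c_def inner_diff_right)
      then have gu: "g u = ereal (a + z \<bullet> (u - x))" using sub[of u] by (simp add: antisym)
      have "g u + ereal (z \<bullet> (y - u)) \<le> g y" for y
        using sub[of y] by (simp add: gu inner_diff_right)
      then have "z \<in> subdifferential g u" by (simp add: subdifferential_def gu)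
      then show "u \<in> subdifferential (conjugate g) z" by (rule subdifferential_conjugateI)
    qed
    ultimately show ?thesis by blast
  qed simp
  then have "range (subdifferential (conjugate g)) \<subseteq>
      insert {} ((`) fst ` {F. F exposed_face_of ?E})" by blast
  moreover have "finite \<dots>" using finite_polyhedron_exposed_faces[OF polyE] by simp
  ultimately show ?thesis by (rule finite_subset)
qed

lemma finite_closed_family_near_point:
  fixes x :: "'a::metric_space"
  assumes "finite F" "\<And>C. C \<in> F \<Longrightarrow> closed C"
  obtains \<rho> where "\<rho> > 0" "\<And>C y. C \<in> F \<Longrightarrow> y \<in> C \<Longrightarrow> dist y x < \<rho> \<Longrightarrow> x \<in> C"
proof -
  let ?U = "\<Union>{C \<in> F. x \<notin> C}"
  have "open (- ?U)" using assms by (intro open_Compl closed_Union) auto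
  moreover have "x \<in> - ?U" by auto
  ultimately obtain \<rho> where "\<rho> > 0" "\<forall>y. dist y x < \<rho> \<longrightarrow> y \<in> - ?U"
    unfolding open_dist by blast
  then show thesis using that[of \<rho>] by blast
qed

text \<open>Both conclusions apply the preceding lemma to a finite family of closed sets: the sets
  \<open>\<partial>g\<^sup>*(z)\<close> near \<open>x\<close>, and near \<open>z\<^sub>0\<close> the sets of those \<open>z\<close> for which \<open>\<partial>g\<^sup>*(z)\<close> contains a
  given member of that family.\<close>

lemma subdifferential_conjugate_locally_contained:
  fixes g :: "'a::euclidean_space \<Rightarrow> ereal"
  assumes pr: "proper g" and poly: "convex_polyhedral g"
  obtains \<rho> where "\<rho> > 0"
    "\<And>y z. z \<in> subdifferential g y \<Longrightarrow> dist y x < \<rho> \<Longrightarrow> x \<in> subdifferential (conjugate g) z"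
    "\<And>z. dist z z\<^sub>0 < \<rho> \<Longrightarrow>
       subdifferential (conjugate g) z \<subseteq> subdifferential (conjugate g) z\<^sub>0"
proof -
  let ?S = "subdifferential (conjugate g)"
  let ?K = "\<lambda>C. {z. C \<subseteq> ?S z}"
  note iff = subdifferential_conjugate_iff[OF pr poly]
  note fin = finite_range_subdifferential_conjugate[OF pr poly]
  obtain \<rho>1 where \<rho>1: "\<rho>1 > 0" "\<And>C y. C \<in> range ?S \<Longrightarrow> y \<in> C \<Longrightarrow> dist y x < \<rho>1 \<Longrightarrow> x \<in> C"
    using finite_closed_family_near_point[OF fin] closed_subdifferential by blast
  have "closed (?K C)" for C
  proof -
    have "?K C = (\<Inter>s\<in>C. subdifferential g s)" using iff by blast
    then show ?thesis by (simp add: closed_INT closed_subdifferential)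
  qed
  then obtain \<rho>2 where \<rho>2: "\<rho>2 > 0"
    "\<And>D z. D \<in> ?K ` range ?S \<Longrightarrow> z \<in> D \<Longrightarrow> dist z z\<^sub>0 < \<rho>2 \<Longrightarrow> z\<^sub>0 \<in> D"
    using finite_closed_family_near_point[OF finite_imageI[OF fin, of ?K], of z\<^sub>0] by blast
  show thesis
  proof
    show "min \<rho>1 \<rho>2 > 0" using \<rho>1 \<rho>2 by simp
    show "x \<in> ?S z" if "z \<in> subdifferential g y" "dist y x < min \<rho>1 \<rho>2" for y z
      using \<rho>1(2)[of "?S z" y] that iff by auto
    show "?S z \<subseteq> ?S z\<^sub>0" if "dist z z\<^sub>0 < min \<rho>1 \<rho>2" for z
      using \<rho>2(2)[of "?K (?S z)" z] that by auto
  qed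
qed

lemma subspace_par: "subspace (par C)"
  by (simp add: par_def subspace_span)

lemma diff_mem_par:
  assumes "x \<in> C" "y \<in> C"
  shows "y - x \<in> par C"
  unfolding par_eq[OF assms(1)] using assms(2) by (intro span_base) blast

lemma par_mono:
  assumes "C \<subseteq> D"
  shows "par C \<subseteq> par D"
proof (cases "C = {}")
  case True
  then show ?thesis by (simp add: par_def span_zero)
next
  case False
  then obtain x where "x \<in> C" by blast
  then have "x \<in> D" using assms by blast
  then show ?thesis
    unfolding par_eq[OF \<open>x \<in> C\<close>] par_eq[OF \<open>x \<in> D\<close>] using assms by (intro span_mono image_mono)
qed

text \<open>On \<open>\<partial>g\<^sup>*(z) \<subseteq> \<partial>g\<^sup>*(z\<^sub>0)\<close> the function \<open>g\<close> is affine with slope \<open>z\<close> and also with slope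
  \<open>z\<^sub>0\<close>, so that \<open>z - z\<^sub>0\<close> is normal to that set.\<close>

lemma subgradient_diff_orthogonal_par:
  fixes g :: "'a::euclidean_space \<Rightarrow> ereal"
  assumes pr: "proper g" and poly: "convex_polyhedral g"
    and sub: "subdifferential (conjugate g) z \<subseteq> subdifferential (conjugate g) z\<^sub>0"
    and l: "l \<in> par (subdifferential (conjugate g) z)"
  shows "z \<bullet> l = z\<^sub>0 \<bullet> l"
proof (cases "subdifferential (conjugate g) z = {}")
  case True
  then show ?thesis using l by (simp add: par_def)
next
  case False
  note iff = subdifferential_conjugate_iff[OF pr poly]
  obtain x where x: "x \<in> subdifferential (conjugate g) z" using False by blast
  have "z \<bullet> (u - x) = z\<^sub>0 \<bullet> (u - x)" if "u \<in> subdifferential (conjugate g) z" for u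
  proof -
    have "ereal (z \<bullet> (u - x)) = g u - g x" "ereal (z\<^sub>0 \<bullet> (u - x)) = g u - g x"
      using that x sub iff by (blast intro: common_subgradient_inner)+
    then show ?thesis by (metis ereal.inject)
  qed
  then have "orthogonal (z - z\<^sub>0) s" if "s \<in> (\<lambda>u. u - x) ` subdifferential (conjugate g) z" for s
    using that by (auto simp: orthogonal_def inner_diff_left)
  then have "orthogonal (z - z\<^sub>0) l"
    using l unfolding par_eq[OF x] by (rule orthogonal_to_span[rotated])
  then show ?thesis by (simp add: orthogonal_def inner_diff_left)
qed

section \<open>The Newton step\<close>

text \<open>The derivative is taken at \<open>y\<close>, as in the Newton subproblem, rather than at the center \<open>x\<close>.\<close>

lemma gradient_linearization_error:
  fixes Hf :: "'a::real_normed_vector \<Rightarrow> 'a \<Rightarrow>\<^sub>L 'b::real_normed_vector"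
  assumes Hf: "\<And>x. (F has_derivative blinfun_apply (Hf x)) (at x)"
    and lip: "L-lipschitz_on (ball x r) Hf"
    and y: "y \<in> ball x r"
  shows "norm (F y - F x - blinfun_apply (Hf y) (y - x)) \<le> L * (norm (y - x))\<^sup>2"
proof -
  have r: "r > 0" using y by (metis ball_eq_empty empty_iff not_less)
  have seg: "closed_segment y x \<subseteq> ball x r"
    using y r by (intro closed_segment_subset) auto
  have "norm (F x - F y - blinfun_apply (Hf y) (x - y)) \<le> norm (x - y) * (L * norm (y - x))"
  proof (rule differentiable_bound_linearization[where S = "closed_segment y x"])
    show "y + t *\<^sub>R (x - y) \<in> closed_segment y x" if "t \<in> {0..1}" for t
      using that by (auto simp: in_segment algebra_simps)
    show "(F has_derivative blinfun_apply (Hf u)) (at u within closed_segment y x)" for u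
      using Hf by (rule has_derivative_at_withinI)
    show "onorm (blinfun_apply (Hf u) - blinfun_apply (Hf y)) \<le> L * norm (y - x)"
      if "u \<in> closed_segment y x" for u
    proof -
      have "onorm (blinfun_apply (Hf u) - blinfun_apply (Hf y)) = norm (Hf u - Hf y)"
        by (simp add: norm_blinfun.rep_eq minus_blinfun.rep_eq fun_diff_def)
      also have "\<dots> \<le> L * norm (u - y)"
        using lipschitz_onD[OF lip] that seg y by (auto simp: dist_norm)
      also have "\<dots> \<le> L * norm (y - x)"
        using segment_bound(1)[OF that] lipschitz_on_nonneg[OF lip]
        by (intro mult_left_mono) (auto simp: norm_minus_commute)
      finally show ?thesis .
    qed
  qed auto
  moreover have "F y - F x - blinfun_apply (Hf y) (y - x) =
      - (F x - F y - blinfun_apply (Hf y) (x - y))"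
    by (simp add: blinfun.diff_right)
  then have "norm (F y - F x - blinfun_apply (Hf y) (y - x)) =
      norm (F x - F y - blinfun_apply (Hf y) (x - y))"
    by (simp only: norm_minus_cancel)
  ultimately show ?thesis
    by (simp add: norm_minus_commute[of x y] power2_eq_square mult_ac)
qed

lemma newton_step_local:
  fixes f :: "'a::euclidean_space \<Rightarrow> real" and Hf :: "'a \<Rightarrow> 'a \<Rightarrow>\<^sub>L 'a"
  assumes conv: "convex_on UNIV f"
    and df: "\<And>x. GDERIV f x :> df x"
    and Hf: "\<And>x. (df has_derivative blinfun_apply (Hf x)) (at x)"
    and cont: "continuous_on UNIV Hf"
    and pr: "proper g" and poly: "convex_polyhedral g"
    and ker: "{w. blinfun_apply (Hf xbar) w = 0} \<inter>
           par (subdifferential (conjugate g) (- df xbar)) = {0}"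
    and lip: "r > 0" "L-lipschitz_on (ball xbar r) Hf"
  obtains \<rho> K where "\<rho> > 0" "K > 0"
    "\<And>y z. z \<in> subdifferential g y \<Longrightarrow> dist z (- df xbar) < \<rho> \<Longrightarrow> dist y xbar < \<rho> \<Longrightarrow>
       \<exists>!d. newton_direction df Hf g y z d"
    "\<And>y z d. z \<in> subdifferential g y \<Longrightarrow> dist z (- df xbar) < \<rho> \<Longrightarrow> dist y xbar < \<rho> \<Longrightarrow>
       newton_direction df Hf g y z d \<Longrightarrow> norm (y - d - xbar) \<le> K * (norm (y - xbar))\<^sup>2"
proof -
  let ?S = "subdifferential (conjugate g)"
  let ?z = "- df xbar"
  note iff = subdifferential_conjugate_iff[OF pr poly]
  have isC: "isCont Hf x" for x using cont by (simp add: continuous_on_eq_continuous_at)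
  have sym: "blinfun_apply (Hf x) u \<bullet> v = u \<bullet> blinfun_apply (Hf x) v" for x u v
    by (rule hessian_symmetric[OF df Hf isC])
  have psd: "0 \<le> blinfun_apply (Hf x) u \<bullet> u" for x u
    by (rule convex_hessian_nonneg[OF conv df Hf])
  have "0 < blinfun_apply (Hf xbar) w \<bullet> w" if "w \<in> par (?S ?z)" "w \<noteq> 0" for w
  proof -
    have "blinfun_apply (Hf xbar) w \<noteq> 0" using ker that by blast
    then show ?thesis using psd_isotropic_imp_kernel[OF sym psd] psd[of xbar w] by force
  qed
  then obtain c where c: "c > 0"
    "\<And>w. w \<in> par (?S ?z) \<Longrightarrow> c * (norm w)\<^sup>2 \<le> blinfun_apply (Hf xbar) w \<bullet> w"
    using coercive_on_subspace[OF subspace_par] by blast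
  obtain \<rho>1 where \<rho>1: "\<rho>1 > 0" "\<And>y. dist y xbar < \<rho>1 \<Longrightarrow> dist (Hf y) (Hf xbar) < c / 2"
    using isC[of xbar] c(1) unfolding continuous_at_eps_delta by (metis half_gt_zero)
  have coer: "c / 2 * (norm w)\<^sup>2 \<le> blinfun_apply (Hf y) w \<bullet> w"
    if "w \<in> par (?S ?z)" "dist y xbar < \<rho>1" for y w
  proof -
    have "blinfun_apply (Hf xbar - Hf y) w \<bullet> w \<le> norm (blinfun_apply (Hf xbar - Hf y) w) * norm w"
      by (rule norm_cauchy_schwarz)
    also have "\<dots> \<le> (norm (Hf xbar - Hf y) * norm w) * norm w"
      by (intro mult_right_mono norm_blinfun) auto
    also have "\<dots> \<le> c / 2 * norm w * norm w"
      using \<rho>1(2)[OF that(2)] by (intro mult_right_mono) (auto simp: dist_norm norm_minus_commute)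
    finally show ?thesis
      using c(2)[OF that(1)] by (simp add: blinfun.diff_left inner_diff_left power2_eq_square)
  qed
  obtain \<rho>2 where \<rho>2: "\<rho>2 > 0"
    "\<And>y z. z \<in> subdifferential g y \<Longrightarrow> dist y xbar < \<rho>2 \<Longrightarrow> xbar \<in> ?S z"
    "\<And>z. dist z ?z < \<rho>2 \<Longrightarrow> ?S z \<subseteq> ?S ?z"
    using subdifferential_conjugate_locally_contained[OF pr poly] by blast
  define \<rho> where "\<rho> = min r (min \<rho>1 \<rho>2)"
  define K where "K = 2 * (L + 1) / c"
  have L: "L \<ge> 0" using lip(2) by (rule lipschitz_on_nonneg)
  show thesis
  proof
    show "\<rho> > 0" "K > 0" using lip(1) \<rho>1(1) \<rho>2(1) c(1) L by (auto simp: \<rho>_def K_def)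
  next
    fix y z assume "z \<in> subdifferential g y" and z: "dist z ?z < \<rho>" and y: "dist y xbar < \<rho>"
    have "par (?S z) \<subseteq> par (?S ?z)" using z \<rho>2(3)[of z] by (intro par_mono) (simp add: \<rho>_def)
    then have "c / 2 * (norm w)\<^sup>2 \<le> blinfun_apply (Hf y) w \<bullet> w" if "w \<in> par (?S z)" for w
      using that y by (intro coer) (auto simp: \<rho>_def)
    then show "\<exists>!d. newton_direction df Hf g y z d"
      unfolding newton_direction_def
      using quadratic_argmin_unique[OF sym psd subspace_par] c(1) half_gt_zero by blast
  next
    fix y z d assume zy: "z \<in> subdifferential g y" and z: "dist z ?z < \<rho>" and y: "dist y xbar < \<rho>"
      and d: "newton_direction df Hf g y z d"
    have sub: "?S z \<subseteq> ?S ?z" using z \<rho>2(3)[of z] by (simp add: \<rho>_def)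
    have yx: "y - xbar \<in> par (?S z)"
      using zy y \<rho>2(2)[OF zy] iff by (intro diff_mem_par) (auto simp: \<rho>_def)
    have dmem: "d \<in> par (?S z)" using d by (simp add: newton_direction_def is_arg_min_def)
    define e where "e = d - (y - xbar)"
    have e: "e \<in> par (?S z)" unfolding e_def using dmem yx subspace_par by (rule subspace_diff[rotated 1])
    have "blinfun_apply (Hf y) d \<bullet> e = (z + df y) \<bullet> e"
      using quadratic_argmin_first_order[OF sym psd subspace_par e] d
      unfolding newton_direction_def by blast
    also have "\<dots> = (df y - df xbar) \<bullet> e"
      using subgradient_diff_orthogonal_par[OF pr poly sub e] by (simp add: inner_add_left inner_diff_left)
    finally have He: "blinfun_apply (Hf y) e \<bullet> e =
        (df y - df xbar - blinfun_apply (Hf y) (y - xbar)) \<bullet> e"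
      by (simp add: e_def blinfun.diff_right inner_diff_left)
    have "c / 2 * (norm e)\<^sup>2 \<le> blinfun_apply (Hf y) e \<bullet> e"
      using e par_mono[OF sub] y by (intro coer) (auto simp: \<rho>_def)
    also have "\<dots> \<le> norm (df y - df xbar - blinfun_apply (Hf y) (y - xbar)) * norm e"
      unfolding He by (rule norm_cauchy_schwarz)
    also have "\<dots> \<le> (L * (norm (y - xbar))\<^sup>2) * norm e"
      using y gradient_linearization_error[OF Hf lip(2), of y]
      by (intro mult_right_mono) (auto simp: \<rho>_def dist_commute)
    finally have "norm e * (c / 2 * norm e) \<le> norm e * (L * (norm (y - xbar))\<^sup>2)"
      by (simp add: power2_eq_square mult_ac)
    then have "c / 2 * norm e \<le> L * (norm (y - xbar))\<^sup>2"
      by (cases "e = 0") (use L in \<open>auto simp: mult_le_cancel_left\<close>)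
    also have "\<dots> \<le> (L + 1) * (norm (y - xbar))\<^sup>2" by (intro mult_right_mono) auto
    finally have "norm e \<le> K * (norm (y - xbar))\<^sup>2" using c(1) by (simp add: K_def field_simps)
    moreover have "y - d - xbar = - e" by (simp add: e_def)
    ultimately show "norm (y - d - xbar) \<le> K * (norm (y - xbar))\<^sup>2" by (simp only: norm_minus_cancel)
  qed
qed

lemma halving_tendsto_zero:
  fixes a :: "nat \<Rightarrow> real"
  assumes "\<And>k. 0 \<le> a k" "\<And>k. a (Suc k) \<le> a k / 2"
  shows "a \<longlonglongrightarrow> 0"
proof -
  have le: "a k \<le> a 0 * (1/2) ^ k" for k
  proof (induction k)
    case (Suc k)
    then show ?case using assms(2)[of k] by simp
  qed simp
  have "(\<lambda>k. a 0 * (1/2) ^ k) \<longlonglongrightarrow> 0"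
    by (intro tendsto_mult_right_zero LIMSEQ_power_zero) simp
  moreover have "\<forall>\<^sub>F k in sequentially. norm (a k) \<le> a 0 * (1/2) ^ k"
    using assms(1) le by (intro always_eventually) auto
  ultimately show ?thesis by (rule Lim_null_comparison[rotated])
qed

theorem theorem3p1:
  fixes f :: "'a::euclidean_space \<Rightarrow> real"
    and df :: "'a \<Rightarrow> 'a"
    and Hf :: "'a \<Rightarrow> 'a \<Rightarrow>\<^sub>L 'a"
    and g :: "'a \<Rightarrow> ereal"
    and xbar :: 'a
    and \<eta> :: real
  assumes "convex_on UNIV f"
    and "\<And>x. GDERIV f x :> df x"
    and "\<And>x. (df has_derivative blinfun_apply (Hf x)) (at x)"
    and "continuous_on UNIV Hf"
    and "proper g"
    and "convex_polyhedral g"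
    and "- df xbar \<in> subdifferential g xbar"
    and "{w. blinfun_apply (Hf xbar) w = 0} \<inter>
           par (subdifferential (conjugate g) (- df xbar)) = {0}"
    and "\<exists>r>0. \<exists>L. L-lipschitz_on (ball xbar r) Hf"
    and "\<eta> > 0"
  shows "\<exists>\<epsilon>>0. \<exists>C>0. \<forall>x y z d. norm (x 0 - xbar) \<le> \<epsilon> \<longrightarrow>
           (\<forall>n. newton_run df Hf g xbar \<eta> n x y z d \<and>
                admissible_pair df g xbar \<eta> (x n) (y n) (z n) \<longrightarrow>
                (\<exists>!e. newton_direction df Hf g (y n) (z n) e)) \<and>
           ((\<forall>n. newton_run df Hf g xbar \<eta> n x y z d) \<longrightarrow>
                x \<longlonglongrightarrow> xbar \<and>
                (\<forall>k. norm (x (Suc k) - xbar) \<le> C * (norm (x k - xbar))\<^sup>2))"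
proof -
  obtain r L where lip: "r > 0" "L-lipschitz_on (ball xbar r) Hf" using assms(9) by blast
  obtain \<rho> K where \<rho>: "\<rho> > 0" and K: "K > 0" and
    unique: "\<And>y z. z \<in> subdifferential g y \<Longrightarrow> dist z (- df xbar) < \<rho> \<Longrightarrow> dist y xbar < \<rho> \<Longrightarrow>
       \<exists>!d. newton_direction df Hf g y z d" and
    step: "\<And>y z d. z \<in> subdifferential g y \<Longrightarrow> dist z (- df xbar) < \<rho> \<Longrightarrow> dist y xbar < \<rho> \<Longrightarrow>
       newton_direction df Hf g y z d \<Longrightarrow> norm (y - d - xbar) \<le> K * (norm (y - xbar))\<^sup>2"
    using newton_step_local[OF assms(1-6,8) lip] by blast
  define C where "C = K * \<eta>\<^sup>2"
  \<comment> \<open>The first bound keeps admissible pairs within \<open>\<rho>\<close>, the second makes each step halve the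
    distance to the solution.\<close>
  define \<epsilon> where "\<epsilon> = min (\<rho> / (2 * \<eta>)) (1 / (2 * C))"
  have C: "C > 0" using K assms(10) by (simp add: C_def)
  have \<epsilon>: "\<epsilon> > 0" using \<rho> C assms(10) by (simp add: \<epsilon>_def)
  have near: "z \<in> subdifferential g y \<and> dist z (- df xbar) < \<rho> \<and> dist y xbar < \<rho> \<and>
      norm (y - xbar) \<le> \<eta> * norm (x - xbar)"
    if "admissible_pair df g xbar \<eta> x y z" "norm (x - xbar) \<le> \<epsilon>" for x y z
  proof -
    have "\<eta> * norm (x - xbar) \<le> \<eta> * (\<rho> / (2 * \<eta>))"
      using that(2) assms(10) by (intro mult_left_mono) (auto simp: \<epsilon>_def)
    also have "\<dots> < \<rho>" using \<rho> assms(10) by simp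
    finally have "\<eta> * norm (x - xbar) < \<rho>" .
    moreover have "z \<in> subdifferential g y"
      "norm (z - (- df xbar)) + norm (y - xbar) \<le> \<eta> * norm (x - xbar)"
      using that(1) by (auto simp: admissible_pair_def)
    moreover have "0 \<le> norm (z - (- df xbar))" "0 \<le> norm (y - xbar)" by auto
    ultimately show ?thesis unfolding dist_norm by linarith
  qed
  have quad: "norm (y - d - xbar) \<le> C * (norm (x - xbar))\<^sup>2 \<and>
      norm (y - d - xbar) \<le> norm (x - xbar) / 2"
    if adm: "admissible_pair df g xbar \<eta> x y z" and x: "norm (x - xbar) \<le> \<epsilon>"
      and d: "newton_direction df Hf g y z d" for x y z d
  proof -
    have "norm (y - d - xbar) \<le> K * (norm (y - xbar))\<^sup>2" using near[OF adm x] d step by blast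
    also have "\<dots> \<le> K * (\<eta> * norm (x - xbar))\<^sup>2"
      using near[OF adm x] K by (intro mult_left_mono power_mono) auto
    finally have 1: "norm (y - d - xbar) \<le> C * (norm (x - xbar))\<^sup>2"
      by (simp add: C_def power_mult_distrib mult_ac)
    have "C * norm (x - xbar) \<le> C * (1 / (2 * C))"
      using x C by (intro mult_left_mono) (auto simp: \<epsilon>_def)
    then have "C * norm (x - xbar) \<le> 1 / 2" using C by simp
    then have "C * norm (x - xbar) * norm (x - xbar) \<le> 1 / 2 * norm (x - xbar)"
      by (rule mult_right_mono) simp
    then show ?thesis using 1 by (simp add: power2_eq_square mult_ac)
  qed
  show ?thesis
  proof (rule exI[of _ \<epsilon>], rule conjI[OF \<epsilon>], rule exI[of _ C], rule conjI[OF C], intro allI impI)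
    fix x y z d :: "nat \<Rightarrow> 'a"
    assume x0: "norm (x 0 - xbar) \<le> \<epsilon>"
    have inv: "norm (x n - xbar) \<le> \<epsilon>" if "newton_run df Hf g xbar \<eta> n x y z d" for n
      using that
    proof (induction n)
      case (Suc n)
      then have "norm (x n - xbar) \<le> \<epsilon>" by (simp add: newton_run_def)
      then have "norm (x (Suc n) - xbar) \<le> norm (x n - xbar) / 2"
        using Suc.prems quad[of "x n" "y n" "z n" "d n"] by (simp add: newton_run_def)
      also have "\<dots> \<le> norm (x n - xbar)" by simp
      finally show ?case using \<open>norm (x n - xbar) \<le> \<epsilon>\<close> by linarith
    qed (use x0 in simp)
    have "\<exists>!e. newton_direction df Hf g (y n) (z n) e"
      if "newton_run df Hf g xbar \<eta> n x y z d"
        "admissible_pair df g xbar \<eta> (x n) (y n) (z n)" for n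
      using near[OF that(2) inv[OF that(1)]] unique by blast
    moreover have "x \<longlonglongrightarrow> xbar \<and> (\<forall>k. norm (x (Suc k) - xbar) \<le> C * (norm (x k - xbar))\<^sup>2)"
      if run: "\<forall>n. newton_run df Hf g xbar \<eta> n x y z d"
    proof -
      have q: "norm (x (Suc k) - xbar) \<le> C * (norm (x k - xbar))\<^sup>2 \<and>
          norm (x (Suc k) - xbar) \<le> norm (x k - xbar) / 2" for k
      proof -
        have "newton_run df Hf g xbar \<eta> (Suc k) x y z d" using run by blast
        then have "admissible_pair df g xbar \<eta> (x k) (y k) (z k)"
          "newton_direction df Hf g (y k) (z k) (d k)" "x (Suc k) = y k - d k"
          by (simp_all add: newton_run_def)
        moreover have "norm (x k - xbar) \<le> \<epsilon>" using inv run by blast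
        ultimately show ?thesis using quad by simp
      qed
      have "norm (x (Suc k) - xbar) \<le> norm (x k - xbar) / 2" for k using q by blast
      then have "(\<lambda>k. norm (x k - xbar)) \<longlonglongrightarrow> 0"
        by (rule halving_tendsto_zero[OF norm_ge_zero])
      then have "x \<longlonglongrightarrow> xbar" by (rule LIM_zero_cancel[OF tendsto_norm_zero_cancel])
      then show ?thesis using q by blast
    qed
    ultimately show "(\<forall>n. newton_run df Hf g xbar \<eta> n x y z d \<and>
          admissible_pair df g xbar \<eta> (x n) (y n) (z n) \<longrightarrow>
          (\<exists>!e. newton_direction df Hf g (y n) (z n) e)) \<and>
        ((\<forall>n. newton_run df Hf g xbar \<eta> n x y z d) \<longrightarrow>
          x \<longlonglongrightarrow> xbar \<and> (\<forall>k. norm (x (Suc k) - xbar) \<le> C * (norm (x k - xbar))\<^sup>2))"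
      by blast
  qed
qed

end
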